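(* Let $\lambda_{\max}=\max_{S\in\mathbb S}\lambda_S$ and suppose $\|\bar r_S\|_\infty\le C$ for all $S\in\mathbb S$. Choosing $\eta=|\mathbb S|^{-1}$ and writing $\kappa=|\mathbb S|(1+C\lambda_{\max})$, we have $$\mathcal L(\alpha_{\mathbb S}^{(M)})-\mathcal L(\alpha_{\mathbb S}^* )\le\kappa(1-1/\kappa)^M\,\mathrm{Var}\,a(X)$$ for all $M\in\mathbb N_0$. Moreover, $\mathcal L(\alpha_{\mathbb S}^{(M+1)})\le\mathcal L(\alpha_{\mathbb S}^{(M)})$ for all $M\in\mathbb N_0$.
   Context: Let $d\ge 2$, $[d]=\{1,\dots,d\}$, let $f$ be a probability density on $\mathbb R^d$ and $X\sim f$. For $x\in\mathbb R^d$, $S\subseteq[d]$ write $x_S=(x_j:j\in S)\in\mathbb R^S$ and $f_S$ for the density of $X_S$. Let $\mathbb S\subseteq 2^{[d]}\setminus\{[d]\}$ be nonempty, and for $S\in\mathbb S$ let $\lambda_S\in(0,\infty)$ and let $r_S:\mathbb R^S\to(0,\infty)$ be measurable with normalised version $\bar r_S=r_S/\int r_Sf_S$. Let $a:\mathbb R^d\to\mathbb R$ be measurable with $\int a^2f<\infty$. $L^2=\{\alpha:\mathbb R^d\to\mathbb R:\int\alpha^2f<\infty\}$, $H_S=\{\alpha_S\in L^2:\alpha_S(x)\equiv\alpha_S(x_S),\int\alpha_Sf=0\}$, $H_{\mathbb S}=\prod_{S\in\mathbb S}H_S$, and for $\alpha_{\mathbb S}\in H_{\mathbb S}$ $$\mathcal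 L(\alpha_{\mathbb S})=\mathrm{Var}\Bigl(a(X)-\sum_{S\in\mathbb S}\alpha_S(X_S)\Bigr)+\sum_{S\in\mathbb S}\mathbb E\Bigl[\frac{\alpha_S(X_S)^2}{\lambda_S\bar r_S(X_S)}\Bigr].$$ $\alpha_{\mathbb S}^*$ denotes the unique minimiser of $\mathcal L$ over $H_{\mathbb S}$. Iterates. For a step size $\eta\in(0,1]$ set $\alpha_{\mathbb S}^{(0)}=0$ and, for $m\ge 0$ and $S\in\mathbb S$, $$\alpha_S^{(m+1)}(x_S)=(1-\eta)\alpha_S^{(m)}(x_S)+\eta\frac{\lambda_S\bar r_S(x_S)}{1+\lambda_S\bar r_S(x_S)}\mathbb E\Bigl\{a(X)-\sum_{S'\in\mathbb S\setminus\{S\}}\alpha_{S'}^{(m)}(X_{S'})-\theta'\Bigm|X_S=x_S\Bigr\},$$ where the constant $\theta'=\theta'_{S,m}$ is chosen so that $\mathbb E\{\alpha_S^{(m+1)}(X_S)\}=0$. *)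

theory Defs
  imports "HOL-Probability.Probability"
begin

text \<open>
  The random vector \<open>X\<close> is the identity on the probability space \<open>law f\<close>, so \<open>E g(X)\<close> is the
  integral of \<open>g\<close> with respect to \<open>law f\<close>. The coordinates \<open>[d]\<close> are a finite type \<open>'d\<close>.
\<close>

definition prob_density :: "(real ^ 'd \<Rightarrow> real) \<Rightarrow> bool" where
  "prob_density f \<longleftrightarrow> (\<forall>x. 0 \<le> f x) \<and> has_bochner_integral lborel f 1"

definition law :: "(real ^ 'd \<Rightarrow> real) \<Rightarrow> (real ^ 'd) measure" where
  "law f = density lborel (\<lambda>x. ennreal (f x))"

text \<open>
  \<open>R^S\<close> is the space of \<open>Pi\<^sub>M S (\<lambda>_. borel)\<close>, i.e. the functions on \<open>S\<close> that are
  \<open>undefined\<close> outside \<open>S\<close>; \<open>coords S x\<close> is \<open>x_S\<close>.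
\<close>

definition coords :: "'d set \<Rightarrow> real ^ 'd \<Rightarrow> ('d \<Rightarrow> real)" where
  "coords S x = (\<lambda>j\<in>S. x $ j)"

definition coords_algebra :: "'d set \<Rightarrow> (real ^ 'd) measure" where
  "coords_algebra S = vimage_algebra UNIV (coords S) (Pi\<^sub>M S (\<lambda>_. borel))"

definition glue :: "'d set \<Rightarrow> ('d \<Rightarrow> real) \<Rightarrow> ('d \<Rightarrow> real) \<Rightarrow> real ^ 'd" where
  "glue S z y = (\<chi> j. if j \<in> S then z j else y j)"

definition marginal_density :: "(real ^ 'd \<Rightarrow> real) \<Rightarrow> 'd set \<Rightarrow> ('d \<Rightarrow> real) \<Rightarrow> real" where
  "marginal_density f S z = (LINT y | Pi\<^sub>M (- S) (\<lambda>_. lborel). f (glue S z y))"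

definition normalised ::
  "(real ^ 'd \<Rightarrow> real) \<Rightarrow> ('d set \<Rightarrow> ('d \<Rightarrow> real) \<Rightarrow> real) \<Rightarrow> 'd set \<Rightarrow> ('d \<Rightarrow> real) \<Rightarrow> real" where
  "normalised f r S z = r S z / (LINT u | Pi\<^sub>M S (\<lambda>_. lborel). r S u * marginal_density f S u)"

definition L2 :: "(real ^ 'd \<Rightarrow> real) \<Rightarrow> (real ^ 'd \<Rightarrow> real) set" where
  "L2 f = {\<alpha> \<in> borel_measurable borel. integrable lborel (\<lambda>x. (\<alpha> x)\<^sup>2 * f x)}"

definition H :: "(real ^ 'd \<Rightarrow> real) \<Rightarrow> 'd set \<Rightarrow> (real ^ 'd \<Rightarrow> real) set" where
  "H f S = {\<alpha> \<in> L2 f. (\<forall>x y. coords S x = coords S y \<longrightarrow> \<alpha> x = \<alpha> y) \<and>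
                       (LINT x | lborel. \<alpha> x * f x) = 0}"

definition H_prod :: "(real ^ 'd \<Rightarrow> real) \<Rightarrow> 'd set set \<Rightarrow> ('d set \<Rightarrow> real ^ 'd \<Rightarrow> real) set" where
  "H_prod f SS = (\<Pi>\<^sub>E S\<in>SS. H f S)"

text \<open>
  The penalty \<open>E[\<alpha>_S(X_S)^2 / (lam_S rbar_S(X_S))]\<close> may be infinite on \<open>H_prod f SS\<close>, so it is a
  nonnegative Lebesgue integral and the loss takes values in \<open>ereal\<close>.
\<close>

definition loss ::
  "(real ^ 'd \<Rightarrow> real) \<Rightarrow> (real ^ 'd \<Rightarrow> real) \<Rightarrow> 'd set set \<Rightarrow> ('d set \<Rightarrow> real) \<Rightarrow>
   ('d set \<Rightarrow> ('d \<Rightarrow> real) \<Rightarrow> real) \<Rightarrow> ('d set \<Rightarrow> real ^ 'd \<Rightarrow> real) \<Rightarrow> ereal" where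
  "loss f a SS lam r \<alpha> =
     ereal (prob_space.variance (law f) (\<lambda>x. a x - (\<Sum>S\<in>SS. \<alpha> S x))) +
     (\<Sum>S\<in>SS. enn2ereal (\<integral>\<^sup>+ x. ennreal ((\<alpha> S x)\<^sup>2 / (lam S * normalised f r S (coords S x))) \<partial>law f))"

text \<open>
  One update of component \<open>S\<close> with the centring constant \<open>t\<close> left free. The conditional
  expectation given \<open>X_S\<close> is taken with respect to the sigma-algebra generated by \<open>X_S\<close>; the
  library's version is measurable for it, hence a function of \<open>x_S\<close>.
\<close>

definition update ::
  "(real ^ 'd \<Rightarrow> real) \<Rightarrow> (real ^ 'd \<Rightarrow> real) \<Rightarrow> 'd set set \<Rightarrow> ('d set \<Rightarrow> real) \<Rightarrow>
   ('d set \<Rightarrow> ('d \<Rightarrow> real) \<Rightarrow> real) \<Rightarrow> real \<Rightarrow> ('d set \<Rightarrow> real ^ 'd \<Rightarrow> real) \<Rightarrow>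
   'd set \<Rightarrow> real \<Rightarrow> real ^ 'd \<Rightarrow> real" where
  "update f a SS lam r \<eta> \<alpha> S t x =
     (1 - \<eta>) * \<alpha> S x +
     \<eta> * (lam S * normalised f r S (coords S x) / (1 + lam S * normalised f r S (coords S x))) *
       real_cond_exp (law f) (coords_algebra S) (\<lambda>y. a y - (\<Sum>S'\<in>SS - {S}. \<alpha> S' y) - t) x"

text \<open>The centring constant is unique: the expectation is affine in \<open>t\<close> with negative slope.\<close>

definition centring ::
  "(real ^ 'd \<Rightarrow> real) \<Rightarrow> (real ^ 'd \<Rightarrow> real) \<Rightarrow> 'd set set \<Rightarrow> ('d set \<Rightarrow> real) \<Rightarrow>
   ('d set \<Rightarrow> ('d \<Rightarrow> real) \<Rightarrow> real) \<Rightarrow> real \<Rightarrow> ('d set \<Rightarrow> real ^ 'd \<Rightarrow> real) \<Rightarrow>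
   'd set \<Rightarrow> real" where
  "centring f a SS lam r \<eta> \<alpha> S = (THE t. (LINT x | law f. update f a SS lam r \<eta> \<alpha> S t x) = 0)"

primrec iterate ::
  "(real ^ 'd \<Rightarrow> real) \<Rightarrow> (real ^ 'd \<Rightarrow> real) \<Rightarrow> 'd set set \<Rightarrow> ('d set \<Rightarrow> real) \<Rightarrow>
   ('d set \<Rightarrow> ('d \<Rightarrow> real) \<Rightarrow> real) \<Rightarrow> real \<Rightarrow> nat \<Rightarrow> 'd set \<Rightarrow> real ^ 'd \<Rightarrow> real" where
  "iterate f a SS lam r \<eta> 0 = (\<lambda>S x. 0)"
| "iterate f a SS lam r \<eta> (Suc m) =
     (\<lambda>S. update f a SS lam r \<eta> (iterate f a SS lam r \<eta> m) S
            (centring f a SS lam r \<eta> (iterate f a SS lam r \<eta> m) S))"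

end

theory Submission
  imports Defs
begin

text \<open>
  With \<open>w\<^sub>S = 1 / (\<lambda>\<^sub>S r\<^sub>S)\<close>, where \<open>r\<^sub>S\<close> is normalised, the loss is a quadratic functional of the
  components,
  \<open>L(\<alpha>) = E[(a - E a - \<Sum> \<alpha>\<^sub>S)\<^sup>2] + \<Sum> E[w\<^sub>S \<alpha>\<^sub>S\<^sup>2]\<close>.
  Minimising it in the component \<open>S\<close> alone, with the others held fixed, gives a component
  \<open>b\<^sub>S = E[a - (\<Sum>\<^bsub>S' \<noteq> S\<^esub> \<alpha>\<^sub>S') - t | X\<^sub>S] / (1 + w\<^sub>S)\<close>, and since
  \<open>\<lambda>\<^sub>S r\<^sub>S / (1 + \<lambda>\<^sub>S r\<^sub>S) = 1 / (1 + w\<^sub>S)\<close>, an update with step size \<open>\<eta>\<close> moves every \<open>\<alpha>\<^sub>S\<close>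
  simultaneously by \<open>- \<eta> (\<alpha>\<^sub>S - b\<^sub>S)\<close>. The orthogonality relations that characterise the \<open>b\<^sub>S\<close>
  turn the Taylor expansion of \<open>L\<close> at \<open>\<alpha>\<close> into (\<open>energy_expansion\<close>)
  \<open>L(\<alpha> - h) = L(\<alpha>) - 2 \<Sum> E[(1 + w\<^sub>S) (\<alpha>\<^sub>S - b\<^sub>S) h\<^sub>S] + E[(\<Sum> h\<^sub>S)\<^sup>2] + \<Sum> E[w\<^sub>S h\<^sub>S\<^sup>2]\<close>.

  Everything follows from this identity for two choices of \<open>h\<close>. Write \<open>n\<close> for the number of
  components and \<open>D = \<Sum> E[(1 + w\<^sub>S) (\<alpha>\<^sub>S - b\<^sub>S)\<^sup>2]\<close>. For \<open>h = (\<alpha> - b) / n\<close>, the Cauchy-Schwarz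
  inequality bounds the square of the sum, and the loss drops by at least \<open>D / n\<close>
  (\<open>energy_decrease\<close>); in particular it never increases. For \<open>h = \<alpha> - \<beta>\<close> with a competitor
  \<open>\<beta>\<close>, completing the square in each component gives
  \<open>L(\<alpha>) - L(\<beta>) \<le> \<Sum> E[(1 + w\<^sub>S)\<^sup>2 / w\<^sub>S (\<alpha>\<^sub>S - b\<^sub>S)\<^sup>2] \<le> (1 + K) D\<close>,
  where \<open>K = C \<lambda>\<^sub>m\<^sub>a\<^sub>x\<close> dominates \<open>1 / w\<^sub>S\<close> (\<open>energy_gap\<close>). Together, one update multiplies the
  gap to \<open>\<beta>\<close> by at most \<open>1 - 1 / (n (1 + K)) = 1 - 1 / \<kappa>\<close>, and the initial gap is at most
  \<open>L(0) = Var a\<close>.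

  The argument takes place on an abstract probability space with one sub-sigma-algebra for each
  component. The passage from densities to that setting needs that the normalising constants
  \<open>\<integral> r\<^sub>S f\<^sub>S\<close> are positive, which holds because \<open>f\<^sub>S\<close> has integral 1 by Fubini's theorem.
\<close>

section \<open>Penalised additive least squares on a probability space\<close>

lemma integrable_weighted_mult:
  fixes p g h :: "'a \<Rightarrow> real"
  assumes [measurable]: "p \<in> borel_measurable M" "g \<in> borel_measurable M" "h \<in> borel_measurable M"
    and p: "\<And>x. 0 \<le> p x"
    and int: "integrable M (\<lambda>x. p x * (g x)\<^sup>2)" "integrable M (\<lambda>x. p x * (h x)\<^sup>2)"
  shows "integrable M (\<lambda>x. p x * (g x * h x))"
proof (rule Bochner_Integration.integrable_bound[OF Bochner_Integration.integrable_add[OF int]])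
  have "\<bar>u * v\<bar> \<le> u\<^sup>2 + v\<^sup>2" for u v :: real
  proof -
    have "2 * \<bar>u * v\<bar> \<le> u\<^sup>2 + v\<^sup>2"
      using sum_squares_bound[of "\<bar>u\<bar>" "\<bar>v\<bar>"] by (simp add: abs_mult mult.assoc)
    then show ?thesis by linarith
  qed
  then have "p x * \<bar>g x * h x\<bar> \<le> p x * ((g x)\<^sup>2 + (h x)\<^sup>2)" for x
    using p by (intro mult_left_mono) auto
  then show "AE x in M. norm (p x * (g x * h x)) \<le> norm (p x * (g x)\<^sup>2 + p x * (h x)\<^sup>2)"
    using p by (auto simp: abs_mult distrib_left)
qed simp

text \<open>
  The sigma-algebra \<open>F i\<close> carries the information in \<open>X\<^sub>S\<close>, and \<open>w i\<close> is the weight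
  \<open>1 / (\<lambda>\<^sub>S r\<^sub>S)\<close> of the quadratic penalty. The bound on \<open>1 / w\<close> is the strong convexity of the
  penalty relative to the curvature \<open>1 + w\<close> of the loss in a single component.
\<close>

locale penalised_additive_model = prob_space M for M :: "'a measure" +
  fixes I :: "'i set" and F :: "'i \<Rightarrow> 'a measure" and w :: "'i \<Rightarrow> 'a \<Rightarrow> real"
    and a :: "'a \<Rightarrow> real" and K :: real
  assumes finite_I: "finite I" and nonempty_I: "I \<noteq> {}"
    and subalg: "i \<in> I \<Longrightarrow> subalgebra M (F i)"
    and w_measurable: "i \<in> I \<Longrightarrow> w i \<in> borel_measurable (F i)"
    and w_pos: "i \<in> I \<Longrightarrow> 0 < w i x"
    and w_bound: "i \<in> I \<Longrightarrow> AE x in M. 1 \<le> K * w i x"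
    and a_measurable [measurable]: "a \<in> borel_measurable M"
    and a_square: "integrable M (\<lambda>x. (a x)\<^sup>2)"
begin

text \<open>
  The elements of \<open>H\<^sub>S\<close> with finite penalty. The squared norm that is natural here is the one with
  weight \<open>1 + w\<close>: it is the second-order term of the loss in a single component.
\<close>

definition component :: "'i \<Rightarrow> ('a \<Rightarrow> real) set" where
  "component i = {h \<in> borel_measurable (F i).
     integrable M (\<lambda>x. (1 + w i x) * (h x)\<^sup>2) \<and> expectation h = 0}"

definition energy :: "('i \<Rightarrow> 'a \<Rightarrow> real) \<Rightarrow> real" where
  "energy \<alpha> = expectation (\<lambda>x. (a x - expectation a - (\<Sum>i\<in>I. \<alpha> i x))\<^sup>2) +
     (\<Sum>i\<in>I. expectation (\<lambda>x. w i x * (\<alpha> i x)\<^sup>2))"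

text \<open>
  The minimiser over the component \<open>i\<close> when the others are fixed, up to the choice of the Lagrange
  multiplier \<open>t\<close> of the constraint that the expectation vanishes.
\<close>

definition target :: "('i \<Rightarrow> 'a \<Rightarrow> real) \<Rightarrow> 'i \<Rightarrow> real \<Rightarrow> 'a \<Rightarrow> real" where
  "target \<alpha> i t x = real_cond_exp M (F i) (\<lambda>y. a y - (\<Sum>j\<in>I - {i}. \<alpha> j y) - t) x / (1 + w i x)"

text \<open>
  Minimality of \<open>b i\<close> is expressed by the normal equations in \<open>component i\<close>, the only form in which
  it enters the analysis.
\<close>

definition block_minimisers :: "('i \<Rightarrow> 'a \<Rightarrow> real) \<Rightarrow> ('i \<Rightarrow> 'a \<Rightarrow> real) \<Rightarrow> bool" where
  "block_minimisers \<alpha> b \<longleftrightarrow> (\<forall>i\<in>I. b i \<in> component i \<and> (\<forall>h\<in>component i.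
     expectation (\<lambda>x. (1 + w i x) * (b i x * h x)) =
     expectation (\<lambda>x. (a x - (\<Sum>j\<in>I - {i}. \<alpha> j x)) * h x)))"

lemma w_measurable_M [measurable]: "i \<in> I \<Longrightarrow> w i \<in> borel_measurable M"
  using measurable_from_subalg[OF subalg w_measurable] .

lemma component_measurable: "i \<in> I \<Longrightarrow> h \<in> component i \<Longrightarrow> h \<in> borel_measurable M"
  using measurable_from_subalg[OF subalg] by (auto simp: component_def)

lemma component_expectation: "h \<in> component i \<Longrightarrow> expectation h = 0"
  by (simp add: component_def)

lemma component_square:
  assumes "i \<in> I" "h \<in> component i"
  shows "integrable M (\<lambda>x. (h x)\<^sup>2)" "integrable M (\<lambda>x. w i x * (h x)\<^sup>2)"
proof -
  note [measurable] = component_measurable[OF assms] w_measurable_M[OF assms(1)]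
  have int: "integrable M (\<lambda>x. (1 + w i x) * (h x)\<^sup>2)"
    using assms by (simp add: component_def)
  show "integrable M (\<lambda>x. (h x)\<^sup>2)"
    by (rule Bochner_Integration.integrable_bound[OF int])
      (use w_pos[OF assms(1)] in \<open>auto intro!: AE_I2 simp: distrib_right less_imp_le\<close>)
  show "integrable M (\<lambda>x. w i x * (h x)\<^sup>2)"
    by (rule Bochner_Integration.integrable_bound[OF int])
      (use w_pos[OF assms(1)] in \<open>auto intro!: AE_I2 simp: distrib_right less_imp_le abs_mult\<close>)
qed

lemma componentI:
  assumes "i \<in> I" "h \<in> borel_measurable (F i)" "integrable M (\<lambda>x. (h x)\<^sup>2)"
    "integrable M (\<lambda>x. w i x * (h x)\<^sup>2)" "expectation h = 0"
  shows "h \<in> component i"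
  using assms by (auto simp: component_def distrib_right intro!: Bochner_Integration.integrable_add)

lemma component_integrable: "i \<in> I \<Longrightarrow> h \<in> component i \<Longrightarrow> integrable M h"
  using square_integrable_imp_integrable[OF component_measurable component_square(1)] by blast

lemma a_integrable: "integrable M a"
  using square_integrable_imp_integrable[OF a_measurable a_square] .

lemma component_diff_scaled:
  assumes i: "i \<in> I" and g: "g \<in> component i" and h: "h \<in> component i"
  shows "(\<lambda>x. g x - c * h x) \<in> component i"
proof -
  note meas[measurable] = component_measurable[OF i g] component_measurable[OF i h] w_measurable_M[OF i]
  have *: "integrable M (\<lambda>x. p x * (g x - c * h x)\<^sup>2)"
    if p: "p \<in> borel_measurable M" "\<And>x. 0 \<le> p x" "integrable M (\<lambda>x. p x * (g x)\<^sup>2)"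
      "integrable M (\<lambda>x. p x * (h x)\<^sup>2)" for p
  proof -
    have "(\<lambda>x. p x * (g x - c * h x)\<^sup>2) =
      (\<lambda>x. p x * (g x)\<^sup>2 + c\<^sup>2 * (p x * (h x)\<^sup>2) - 2 * c * (p x * (g x * h x)))"
      by (auto simp: power2_eq_square algebra_simps)
    then show ?thesis
      using integrable_weighted_mult[OF p(1) meas(1,2) p(2-4)] p by auto
  qed
  show ?thesis
  proof (rule componentI[OF i])
    show "(\<lambda>x. g x - c * h x) \<in> borel_measurable (F i)"
      using g h by (auto simp: component_def)
    show "integrable M (\<lambda>x. (g x - c * h x)\<^sup>2)"
      using *[of "\<lambda>_. 1"] component_square[OF i g] component_square[OF i h] by simp
    show "integrable M (\<lambda>x. w i x * (g x - c * h x)\<^sup>2)"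
      using *[of "w i"] component_square[OF i g] component_square[OF i h] w_pos[OF i] by (simp add: less_imp_le)
    show "expectation (\<lambda>x. g x - c * h x) = 0"
      using component_integrable[OF i g] component_integrable[OF i h]
        component_expectation[OF g] component_expectation[OF h] by simp
  qed
qed

lemma square_integrable_mult:
  fixes g h :: "'a \<Rightarrow> real"
  assumes "g \<in> borel_measurable M" "h \<in> borel_measurable M"
    "integrable M (\<lambda>x. (g x)\<^sup>2)" "integrable M (\<lambda>x. (h x)\<^sup>2)"
  shows "integrable M (\<lambda>x. g x * h x)"
  using integrable_weighted_mult[of "\<lambda>_. 1" M g h] assms by simp

lemma square_integrable_diff:
  fixes g h :: "'a \<Rightarrow> real"
  assumes "g \<in> borel_measurable M" "h \<in> borel_measurable M"
    "integrable M (\<lambda>x. (g x)\<^sup>2)" "integrable M (\<lambda>x. (h x)\<^sup>2)"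
  shows "integrable M (\<lambda>x. (g x - h x)\<^sup>2)"
proof -
  have "(\<lambda>x. (g x - h x)\<^sup>2) = (\<lambda>x. (g x)\<^sup>2 + (h x)\<^sup>2 - 2 * (g x * h x))"
    by (auto simp: power2_eq_square algebra_simps)
  then show ?thesis
    using assms square_integrable_mult[OF assms] by auto
qed

lemma component_mult:
  assumes "i \<in> I" "j \<in> I" "g \<in> component i" "h \<in> component j"
  shows "integrable M (\<lambda>x. g x * h x)"
  by (rule square_integrable_mult[OF component_measurable[OF assms(1,3)]
        component_measurable[OF assms(2,4)] component_square(1)[OF assms(1,3)]
        component_square(1)[OF assms(2,4)]])

lemma component_weighted_mult:
  assumes "i \<in> I" "g \<in> component i" "h \<in> component i"
  shows "integrable M (\<lambda>x. w i x * (g x * h x))"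
  using less_imp_le[OF w_pos[OF assms(1)]]
  by (rule integrable_weighted_mult[OF w_measurable_M[OF assms(1)] component_measurable[OF assms(1,2)]
        component_measurable[OF assms(1,3)] _ component_square(2)[OF assms(1,2)]
        component_square(2)[OF assms(1,3)]])

lemma component_sum_square:
  assumes "J \<subseteq> I" "\<And>j. j \<in> J \<Longrightarrow> h j \<in> component j"
  shows "integrable M (\<lambda>x. (\<Sum>j\<in>J. h j x)\<^sup>2)"
proof -
  have "finite J" using finite_subset[OF assms(1) finite_I] .
  have "(\<lambda>x. (\<Sum>j\<in>J. h j x)\<^sup>2) = (\<lambda>x. \<Sum>j\<in>J. \<Sum>k\<in>J. h j x * h k x)"
    by (simp add: power2_eq_square sum_product)
  moreover have "integrable M (\<lambda>x. h j x * h k x)" if "j \<in> J" "k \<in> J" for j k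
    using that assms by (intro component_mult[of j k]) auto
  ultimately show ?thesis by auto
qed

lemma partial_residual_square:
  assumes "J \<subseteq> I" "\<And>j. j \<in> J \<Longrightarrow> \<alpha> j \<in> component j"
  shows "(\<lambda>x. a x - (\<Sum>j\<in>J. \<alpha> j x) - t) \<in> borel_measurable M"
    and "integrable M (\<lambda>x. (a x - (\<Sum>j\<in>J. \<alpha> j x) - t)\<^sup>2)"
proof -
  have [measurable]: "\<alpha> j \<in> borel_measurable M" if "j \<in> J" for j
    using component_measurable that assms by auto
  show "(\<lambda>x. a x - (\<Sum>j\<in>J. \<alpha> j x) - t) \<in> borel_measurable M" by measurable
  show "integrable M (\<lambda>x. (a x - (\<Sum>j\<in>J. \<alpha> j x) - t)\<^sup>2)"
    using component_sum_square[OF assms] a_square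
    by (intro square_integrable_diff) auto
qed

section \<open>The block minimisers as shrunken conditional expectations\<close>

lemma shrink_le:
  assumes "i \<in> I"
  shows "\<bar>y / (1 + w i x)\<bar> \<le> \<bar>y\<bar>"
  using w_pos[OF assms, of x] by (simp add: divide_le_eq mult_le_cancel_left1)

lemma target_integrable:
  assumes i: "i \<in> I" and \<alpha>: "\<And>j. j \<in> I \<Longrightarrow> \<alpha> j \<in> component j"
  shows "integrable M (target \<alpha> i t)"
proof -
  interpret S: finite_measure_subalgebra M "F i"
    by unfold_locales (rule subalg[OF i])
  note [measurable] = w_measurable_M[OF i]
  have "(\<lambda>x. a x - (\<Sum>j\<in>I - {i}. \<alpha> j x) - t) \<in> borel_measurable M"
    "integrable M (\<lambda>x. (a x - (\<Sum>j\<in>I - {i}. \<alpha> j x) - t)\<^sup>2)"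
    using partial_residual_square[of "I - {i}" \<alpha> t] \<alpha> by auto
  then have "integrable M (\<lambda>x. a x - (\<Sum>j\<in>I - {i}. \<alpha> j x) - t)"
    by (rule square_integrable_imp_integrable)
  then have c: "integrable M (real_cond_exp M (F i) (\<lambda>x. a x - (\<Sum>j\<in>I - {i}. \<alpha> j x) - t))"
    by (rule S.real_cond_exp_int(1))
  show ?thesis
    unfolding target_def[abs_def]
    by (rule Bochner_Integration.integrable_bound[OF c]) (use shrink_le[OF i] in auto)
qed

text \<open>
  The expectation of the target is affine in \<open>t\<close> with slope \<open>- E[1 / (1 + w)]\<close>, which is nonzero
  because the integrand is positive.
\<close>

lemma target_centring_unique:
  assumes i: "i \<in> I" and \<alpha>: "\<And>j. j \<in> I \<Longrightarrow> \<alpha> j \<in> component j"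
  shows "\<exists>!t. expectation (target \<alpha> i t) = 0"
proof -
  interpret S: finite_measure_subalgebra M "F i"
    by unfold_locales (rule subalg[OF i])
  let ?u = "\<lambda>x. a x - (\<Sum>j\<in>I - {i}. \<alpha> j x)"
  have u: "?u \<in> borel_measurable M" "integrable M (\<lambda>x. (?u x)\<^sup>2)"
    using partial_residual_square[of "I - {i}" \<alpha> 0] \<alpha> by auto
  have intu: "integrable M ?u"
    by (rule square_integrable_imp_integrable[OF u])
  note [measurable] = w_measurable_M[OF i]
  let ?c = "real_cond_exp M (F i) ?u"
  have w: "0 < 1 + w i x" for x using w_pos[OF i, of x] by simp
  have "AE x in M. target \<alpha> i t x = ?c x / (1 + w i x) - t * (1 / (1 + w i x))" for t
    using S.real_cond_exp_diff[OF intu integrable_const[of t]]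
      S.real_cond_exp_F_meas[OF integrable_const[of t] borel_measurable_const]
    by eventually_elim (simp add: target_def diff_divide_distrib)
  moreover have int1: "integrable M (\<lambda>x. 1 / (1 + w i x))"
    by (rule Bochner_Integration.integrable_bound[of _ "\<lambda>_. 1::real"]) (use shrink_le[OF i, of 1] in auto)
  moreover have intc: "integrable M (\<lambda>x. ?c x / (1 + w i x))"
    by (rule Bochner_Integration.integrable_bound[OF S.real_cond_exp_int(1)[OF intu]])
      (use shrink_le[OF i] in auto)
  ultimately have E: "expectation (target \<alpha> i t) =
    expectation (\<lambda>x. ?c x / (1 + w i x)) - t * expectation (\<lambda>x. 1 / (1 + w i x))" for t
  proof -
    have "expectation (target \<alpha> i t) = expectation (\<lambda>x. ?c x / (1 + w i x) - t * (1 / (1 + w i x)))"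
      using \<open>AE x in M. target \<alpha> i t x = _ x\<close> 
      by (intro integral_cong_AE) (auto simp: target_def[abs_def])
    also have "\<dots> = expectation (\<lambda>x. ?c x / (1 + w i x)) - t * expectation (\<lambda>x. 1 / (1 + w i x))"
      by (simp only: Bochner_Integration.integral_diff[OF intc integrable_mult_right[OF int1]]
          integral_mult_right_zero)
    finally show ?thesis .
  qed
  have "expectation (\<lambda>x. 1 / (1 + w i x)) \<noteq> 0"
  proof
    assume "expectation (\<lambda>x. 1 / (1 + w i x)) = 0"
    then have "AE x in M. 1 / (1 + w i x) = 0"
      using integral_nonneg_eq_0_iff_AE[OF int1] w by (auto simp: less_imp_le)
    then have "AE x in M. False"
      by eventually_elim (use w in \<open>auto simp: less_le\<close>)
    then show False by (simp add: AE_False)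
  qed
  then show ?thesis
    by (intro ex1I[of _ "expectation (\<lambda>x. ?c x / (1 + w i x)) / expectation (\<lambda>x. 1 / (1 + w i x))"])
      (auto simp: E field_simps)
qed

text \<open>
  The factor \<open>1 + w\<close> cancels against the shrinkage, the conditional expectation is self-adjoint
  and \<open>h\<close> is measurable for \<open>F i\<close>, and the constant \<open>t\<close> is orthogonal to \<open>h\<close>. Square
  integrability of the target is Jensen's inequality for conditional expectations.
\<close>

lemma target_block_minimiser:
  assumes i: "i \<in> I" and \<alpha>: "\<And>j. j \<in> I \<Longrightarrow> \<alpha> j \<in> component j"
    and t: "expectation (target \<alpha> i t) = 0"
  shows "target \<alpha> i t \<in> component i"
    and "\<And>h. h \<in> component i \<Longrightarrow> expectation (\<lambda>x. (1 + w i x) * (target \<alpha> i t x * h x)) =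
     expectation (\<lambda>x. (a x - (\<Sum>j\<in>I - {i}. \<alpha> j x)) * h x)"
proof -
  interpret S: finite_measure_subalgebra M "F i"
    by unfold_locales (rule subalg[OF i])
  let ?u = "\<lambda>x. a x - (\<Sum>j\<in>I - {i}. \<alpha> j x)"
  let ?c = "real_cond_exp M (F i) (\<lambda>x. ?u x - t)"
  have u: "(\<lambda>x. ?u x - t) \<in> borel_measurable M" "integrable M (\<lambda>x. (?u x - t)\<^sup>2)"
    using partial_residual_square[of "I - {i}" \<alpha> t] \<alpha> by auto
  have w: "0 < 1 + w i x" for x using w_pos[OF i, of x] by simp
  note [measurable] = w_measurable_M[OF i]
  have "convex_on UNIV (\<lambda>x::real. x\<^sup>2)"
    by (simp add: convex_power_even)
  then have c: "integrable M (\<lambda>x. (?c x)\<^sup>2)"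
    by (intro S.integrable_convex_cond_exp[OF square_integrable_imp_integrable[OF u], of UNIV])
      (use u in auto)
  have bm: "target \<alpha> i t \<in> borel_measurable (F i)"
    using w_measurable[OF i] by (auto simp: target_def[abs_def])
  show "target \<alpha> i t \<in> component i"
    unfolding component_def
  proof (intro CollectI conjI bm t)
    have "(1 + w i x) * (target \<alpha> i t x)\<^sup>2 = (?c x)\<^sup>2 / (1 + w i x)" for x
      using w[of x] by (simp add: target_def power_divide power2_eq_square)
    moreover have "(?c x)\<^sup>2 / (1 + w i x) \<le> (?c x)\<^sup>2" for x
      using w[of x] w_pos[OF i, of x] by (simp add: divide_le_eq mult_le_cancel_left1)
    ultimately show "integrable M (\<lambda>x. (1 + w i x) * (target \<alpha> i t x)\<^sup>2)"
      by (intro Bochner_Integration.integrable_bound[OF c])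
        (use w measurable_from_subalg[OF subalg[OF i] bm] in \<open>auto simp: less_imp_le\<close>)
  qed
  fix h assume h: "h \<in> component i"
  note [measurable] = component_measurable[OF i h]
  have hF: "h \<in> borel_measurable (F i)" using h by (simp add: component_def)
  have int: "integrable M (\<lambda>x. h x * (?u x - t))"
    using u component_square[OF i h] by (intro square_integrable_mult) auto
  have "expectation (\<lambda>x. (1 + w i x) * (target \<alpha> i t x * h x)) = expectation (\<lambda>x. h x * ?c x)"
    using w by (intro Bochner_Integration.integral_cong) (auto simp: target_def less_le field_simps)
  also have "\<dots> = expectation (\<lambda>x. h x * (?u x - t))"
    by (rule S.real_cond_exp_intg(2)[OF int hF u(1)])
  also have "\<dots> = expectation (\<lambda>x. h x * (?u x - t)) + t * expectation h"
    using component_expectation[OF h] by simp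
  also have "\<dots> = expectation (\<lambda>x. h x * (?u x - t) + t * h x)"
    using int component_integrable[OF i h] by simp
  also have "\<dots> = expectation (\<lambda>x. ?u x * h x)"
    by (intro Bochner_Integration.integral_cong) (auto simp: algebra_simps)
  finally show "expectation (\<lambda>x. (1 + w i x) * (target \<alpha> i t x * h x)) =
     expectation (\<lambda>x. ?u x * h x)" .
qed

section \<open>Decrease of the loss in one averaged update\<close>

text \<open>
  The first-order term in direction \<open>h i\<close> is \<open>E[(\<rho> - w \<alpha>) h]\<close> with the full residual \<open>\<rho>\<close>. As
  \<open>\<rho> = u - \<alpha>\<close> up to a constant, with the partial residual \<open>u\<close> that leaves out the component
  \<open>i\<close>, the normal equations for \<open>b\<close> rewrite it as \<open>- E[(1 + w) (\<alpha> - b) h]\<close>.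
\<close>

lemma energy_expansion:
  assumes \<alpha>: "\<And>i. i \<in> I \<Longrightarrow> \<alpha> i \<in> component i" and h: "\<And>i. i \<in> I \<Longrightarrow> h i \<in> component i"
    and b: "block_minimisers \<alpha> b"
  shows "energy (\<lambda>i x. \<alpha> i x - h i x) = energy \<alpha>
    - 2 * (\<Sum>i\<in>I. expectation (\<lambda>x. (1 + w i x) * ((\<alpha> i x - b i x) * h i x)))
    + expectation (\<lambda>x. (\<Sum>i\<in>I. h i x)\<^sup>2) + (\<Sum>i\<in>I. expectation (\<lambda>x. w i x * (h i x)\<^sup>2))"
proof -
  let ?\<rho> = "\<lambda>x. a x - expectation a - (\<Sum>i\<in>I. \<alpha> i x)"
  have m: "\<alpha> i \<in> borel_measurable M" "h i \<in> borel_measurable M" "b i \<in> borel_measurable M"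
    "b i \<in> component i" if "i \<in> I" for i
    using that component_measurable \<alpha> h b by (auto simp: block_minimisers_def)
  have \<rho>: "?\<rho> \<in> borel_measurable M" "integrable M (\<lambda>x. (?\<rho> x)\<^sup>2)"
    using partial_residual_square[OF order_refl \<alpha>, of "expectation a"] by (simp_all add: algebra_simps)
  have \<rho>h: "integrable M (\<lambda>x. ?\<rho> x * h i x)" if "i \<in> I" for i
    by (rule square_integrable_mult[OF \<rho>(1) m(2)[OF that] \<rho>(2) component_square(1)[OF that h[OF that]]])
  have cross: "expectation (\<lambda>x. ?\<rho> x * h i x) - expectation (\<lambda>x. w i x * (\<alpha> i x * h i x)) =
      - expectation (\<lambda>x. (1 + w i x) * ((\<alpha> i x - b i x) * h i x))" if i: "i \<in> I" for i
  proof -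
    let ?u = "\<lambda>x. a x - (\<Sum>j\<in>I - {i}. \<alpha> j x)"
    have u: "?u \<in> borel_measurable M" "integrable M (\<lambda>x. (?u x)\<^sup>2)"
      using partial_residual_square[of "I - {i}" \<alpha> 0] \<alpha> by auto
    have uh: "integrable M (\<lambda>x. ?u x * h i x)"
      by (rule square_integrable_mult[OF u(1) m(2)[OF i] u(2) component_square(1)[OF i h[OF i]]])
    note ints = uh component_integrable[OF i h[OF i]] component_mult[OF i i \<alpha>[OF i] h[OF i]]
      component_weighted_mult[OF i \<alpha>[OF i] h[OF i]] component_mult[OF i i m(4)[OF i] h[OF i]] component_weighted_mult[OF i m(4)[OF i] h[OF i]]
    have "?\<rho> x * h i x = ?u x * h i x - expectation a * h i x - \<alpha> i x * h i x" for x
      using sum.remove[OF finite_I i, of "\<lambda>j. \<alpha> j x"] by (simp add: algebra_simps)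
    then have "expectation (\<lambda>x. ?\<rho> x * h i x) =
      expectation (\<lambda>x. ?u x * h i x) - expectation (\<lambda>x. \<alpha> i x * h i x)"
      using ints component_expectation[OF h[OF i]] by simp
    also have "expectation (\<lambda>x. ?u x * h i x) = expectation (\<lambda>x. (1 + w i x) * (b i x * h i x))"
      using b h i by (auto simp: block_minimisers_def)
    finally show ?thesis
      using ints by (simp add: algebra_simps)
  qed
  have "(\<lambda>x. (a x - expectation a - (\<Sum>i\<in>I. \<alpha> i x - h i x))\<^sup>2) =
    (\<lambda>x. (?\<rho> x)\<^sup>2 + 2 * (\<Sum>i\<in>I. ?\<rho> x * h i x) + (\<Sum>i\<in>I. h i x)\<^sup>2)"
  proof
    fix x
    have "a x - expectation a - (\<Sum>i\<in>I. \<alpha> i x - h i x) = ?\<rho> x + (\<Sum>i\<in>I. h i x)"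
      by (simp add: sum_subtractf)
    then show "(a x - expectation a - (\<Sum>i\<in>I. \<alpha> i x - h i x))\<^sup>2 =
      (?\<rho> x)\<^sup>2 + 2 * (\<Sum>i\<in>I. ?\<rho> x * h i x) + (\<Sum>i\<in>I. h i x)\<^sup>2"
      unfolding sum_distrib_left[symmetric] by (simp only: power2_sum)
  qed
  moreover have "integrable M (\<lambda>x. (\<Sum>i\<in>I. h i x)\<^sup>2)"
    using component_sum_square[OF order_refl h] .
  ultimately have A: "expectation (\<lambda>x. (a x - expectation a - (\<Sum>i\<in>I. \<alpha> i x - h i x))\<^sup>2) =
    expectation (\<lambda>x. (?\<rho> x)\<^sup>2) + 2 * (\<Sum>i\<in>I. expectation (\<lambda>x. ?\<rho> x * h i x)) +
    expectation (\<lambda>x. (\<Sum>i\<in>I. h i x)\<^sup>2)"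
    using \<rho>(2) \<rho>h by (simp add: Bochner_Integration.integral_sum)
  have B: "expectation (\<lambda>x. w i x * (\<alpha> i x - h i x)\<^sup>2) = expectation (\<lambda>x. w i x * (\<alpha> i x)\<^sup>2)
    - 2 * expectation (\<lambda>x. w i x * (\<alpha> i x * h i x)) + expectation (\<lambda>x. w i x * (h i x)\<^sup>2)"
    if i: "i \<in> I" for i
  proof -
    have "(\<lambda>x. w i x * (\<alpha> i x - h i x)\<^sup>2) =
      (\<lambda>x. w i x * (\<alpha> i x)\<^sup>2 - 2 * (w i x * (\<alpha> i x * h i x)) + w i x * (h i x)\<^sup>2)"
      by (auto simp: power2_eq_square algebra_simps)
    then show ?thesis
      using component_square(2)[OF i \<alpha>[OF i]] component_square(2)[OF i h[OF i]]
        component_weighted_mult[OF i \<alpha>[OF i] h[OF i]] by simp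
  qed
  have Bsum: "(\<Sum>i\<in>I. expectation (\<lambda>x. w i x * (\<alpha> i x - h i x)\<^sup>2)) =
    (\<Sum>i\<in>I. expectation (\<lambda>x. w i x * (\<alpha> i x)\<^sup>2))
    - 2 * (\<Sum>i\<in>I. expectation (\<lambda>x. w i x * (\<alpha> i x * h i x)))
    + (\<Sum>i\<in>I. expectation (\<lambda>x. w i x * (h i x)\<^sup>2))"
    unfolding sum_distrib_left sum_subtractf[symmetric] sum.distrib[symmetric]
    by (rule sum.cong[OF refl B])
  have split: "(\<Sum>i\<in>I. expectation (\<lambda>x. ?\<rho> x * h i x) - expectation (\<lambda>x. w i x * (\<alpha> i x * h i x))) =
    (\<Sum>i\<in>I. expectation (\<lambda>x. ?\<rho> x * h i x)) - (\<Sum>i\<in>I. expectation (\<lambda>x. w i x * (\<alpha> i x * h i x)))"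
    by (rule sum_subtractf)
  have "energy (\<lambda>i x. \<alpha> i x - h i x) = energy \<alpha> + 2 * (\<Sum>i\<in>I. expectation (\<lambda>x. ?\<rho> x * h i x) -
      expectation (\<lambda>x. w i x * (\<alpha> i x * h i x)))
    + expectation (\<lambda>x. (\<Sum>i\<in>I. h i x)\<^sup>2) + (\<Sum>i\<in>I. expectation (\<lambda>x. w i x * (h i x)\<^sup>2))"
    unfolding energy_def A Bsum split by simp
  also have "(\<Sum>i\<in>I. expectation (\<lambda>x. ?\<rho> x * h i x) - expectation (\<lambda>x. w i x * (\<alpha> i x * h i x))) =
    - (\<Sum>i\<in>I. expectation (\<lambda>x. (1 + w i x) * ((\<alpha> i x - b i x) * h i x)))"
    by (subst sum.cong[OF refl cross]) (simp_all add: sum_negf)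
  finally show ?thesis by simp
qed

text \<open>
  The sum of the amounts by which the loss would drop if a single component were replaced by its
  block minimiser. It controls both the progress of an update and the distance to optimality.
\<close>

definition discrepancy :: "('i \<Rightarrow> 'a \<Rightarrow> real) \<Rightarrow> ('i \<Rightarrow> 'a \<Rightarrow> real) \<Rightarrow> real" where
  "discrepancy \<alpha> b = (\<Sum>i\<in>I. expectation (\<lambda>x. (1 + w i x) * (\<alpha> i x - b i x)\<^sup>2))"

lemma discrepancy_nonneg: "0 \<le> discrepancy \<alpha> b"
proof -
  have "0 \<le> (1 + w i x) * (\<alpha> i x - b i x)\<^sup>2" if "i \<in> I" for i x
    using w_pos[OF that, of x] by (intro mult_nonneg_nonneg) auto
  then show ?thesis
    unfolding discrepancy_def by (intro sum_nonneg Bochner_Integration.integral_nonneg)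
qed

lemma K_pos: "0 < K"
proof -
  obtain i where i: "i \<in> I" using nonempty_I by blast
  have "AE x in M. 0 < K"
    using w_bound[OF i]
  proof eventually_elim
    case (elim x)
    then have "0 < K * w i x" by linarith
    then show ?case using w_pos[OF i, of x] by (simp add: zero_less_mult_iff)
  qed
  then show ?thesis by simp
qed

text \<open>
  The averaging factor \<open>1 / n\<close> exactly offsets the interaction of the components: the expansion has
  the linear term \<open>- 2 D / n\<close>, and as \<open>(\<Sum> g)\<^sup>2 \<le> n \<Sum> g\<^sup>2\<close>, the quadratic terms return at most
  \<open>D / n\<close>.
\<close>

lemma energy_decrease:
  assumes \<alpha>: "\<And>i. i \<in> I \<Longrightarrow> \<alpha> i \<in> component i" and b: "block_minimisers \<alpha> b"
  defines "n \<equiv> real (card I)"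
  shows "energy (\<lambda>i x. \<alpha> i x - 1 / n * (\<alpha> i x - b i x)) \<le> energy \<alpha> - discrepancy \<alpha> b / n"
proof -
  let ?g = "\<lambda>i x. \<alpha> i x - b i x"
  have "card I > 0" using finite_I nonempty_I by (simp add: card_gt_0_iff)
  then have n: "1 \<le> n" by (simp add: n_def)
  have bc: "b i \<in> component i" if "i \<in> I" for i
    using b that by (auto simp: block_minimisers_def)
  have g: "?g i \<in> component i" if "i \<in> I" for i
    using component_diff_scaled[OF that \<alpha>[OF that] bc[OF that], of 1] by simp
  have gn: "(\<lambda>x. 1 / n * ?g i x) \<in> component i" if "i \<in> I" for i
    using component_diff_scaled[OF that g[OF that] g[OF that], of "1 - 1/n"] by (simp add: algebra_simps)
  let ?E1 = "\<lambda>i. expectation (\<lambda>x. (?g i x)\<^sup>2)" and ?Ew = "\<lambda>i. expectation (\<lambda>x. w i x * (?g i x)\<^sup>2)"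
  have D: "discrepancy \<alpha> b = (\<Sum>i\<in>I. ?E1 i) + (\<Sum>i\<in>I. ?Ew i)"
    unfolding discrepancy_def sum.distrib[symmetric]
    using component_square[OF _ g] by (intro sum.cong) (auto simp: distrib_right)
  have Ew: "0 \<le> ?Ew i" if "i \<in> I" for i
    using w_pos[OF that] by (intro Bochner_Integration.integral_nonneg) (auto simp: less_imp_le)
  have "(\<Sum>i\<in>I. 1 / n * ?g i x)\<^sup>2 \<le> 1 / n * (\<Sum>i\<in>I. (?g i x)\<^sup>2)" for x
  proof -
    have "(\<Sum>i\<in>I. 1 / n * ?g i x)\<^sup>2 = 1 / n\<^sup>2 * (\<Sum>i\<in>I. ?g i x)\<^sup>2"
      by (simp add: sum_distrib_left[symmetric] power_divide sum_divide_distrib[symmetric])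
    also have "\<dots> \<le> 1 / n\<^sup>2 * ((\<Sum>i\<in>I. (?g i x)\<^sup>2) * n)"
      unfolding n_def by (intro mult_left_mono sum_squared_le_sum_of_squares finite_I) auto
    finally show ?thesis using n by (simp add: power2_eq_square field_simps)
  qed
  then have "expectation (\<lambda>x. (\<Sum>i\<in>I. 1 / n * ?g i x)\<^sup>2) \<le> expectation (\<lambda>x. 1 / n * (\<Sum>i\<in>I. (?g i x)\<^sup>2))"
    using component_sum_square[OF order_refl gn] component_square(1)[OF _ g]
    by (intro integral_mono) auto
  also have "\<dots> = 1 / n * (\<Sum>i\<in>I. ?E1 i)"
    using component_square(1)[OF _ g] by (simp add: Bochner_Integration.integral_sum)
  finally have S1: "expectation (\<lambda>x. (\<Sum>i\<in>I. 1 / n * ?g i x)\<^sup>2) \<le> 1 / n * (\<Sum>i\<in>I. ?E1 i)" .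
  have "expectation (\<lambda>x. w i x * (1 / n * ?g i x)\<^sup>2) = 1 / n\<^sup>2 * ?Ew i" for i
    by (subst integral_mult_right_zero[symmetric]) (simp add: power_divide field_simps)
  moreover have "1 / n\<^sup>2 * (\<Sum>i\<in>I. ?Ew i) \<le> 1 / n * (\<Sum>i\<in>I. ?Ew i)"
    using n Ew by (intro mult_right_mono sum_nonneg) (auto simp: power2_eq_square field_simps)
  ultimately have S2: "(\<Sum>i\<in>I. expectation (\<lambda>x. w i x * (1 / n * ?g i x)\<^sup>2)) \<le> 1 / n * (\<Sum>i\<in>I. ?Ew i)"
    by (simp add: sum_distrib_left)
  have scaled: "expectation (\<lambda>x. (1 + w i x) * (?g i x * (1 / n * ?g i x))) =
    1 / n * expectation (\<lambda>x. (1 + w i x) * (?g i x)\<^sup>2)" for i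
    by (subst integral_mult_right_zero[symmetric]) (simp add: power2_eq_square mult.assoc mult.left_commute)
  have S3: "(\<Sum>i\<in>I. expectation (\<lambda>x. (1 + w i x) * (?g i x * (1 / n * ?g i x)))) =
    1 / n * discrepancy \<alpha> b"
    unfolding discrepancy_def sum_distrib_left by (intro sum.cong refl scaled)
  have "energy (\<lambda>i x. \<alpha> i x - 1 / n * ?g i x) = energy \<alpha> - 2 * (1 / n * discrepancy \<alpha> b)
    + expectation (\<lambda>x. (\<Sum>i\<in>I. 1 / n * ?g i x)\<^sup>2)
    + (\<Sum>i\<in>I. expectation (\<lambda>x. w i x * (1 / n * ?g i x)\<^sup>2))"
    unfolding S3[symmetric] by (rule energy_expansion[OF \<alpha> gn b])
  also have "\<dots> \<le> energy \<alpha> - 2 * (1 / n * discrepancy \<alpha> b) + 1 / n * (\<Sum>i\<in>I. ?E1 i) + 1 / n * (\<Sum>i\<in>I. ?Ew i)"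
    using S1 S2 by linarith
  also have "\<dots> = energy \<alpha> - discrepancy \<alpha> b / n"
    unfolding D by (simp add: add_divide_distrib)
  finally show ?thesis .
qed

text \<open>
  In the expansion at \<open>h = \<alpha> - \<beta>\<close> the square of the sum only helps, so the problem decouples into
  the components, where the maximum over \<open>h\<close> is taken pointwise.
\<close>

lemma energy_gap:
  assumes \<alpha>: "\<And>i. i \<in> I \<Longrightarrow> \<alpha> i \<in> component i" and \<beta>: "\<And>i. i \<in> I \<Longrightarrow> \<beta> i \<in> component i"
    and b: "block_minimisers \<alpha> b"
  shows "energy \<alpha> - energy \<beta> \<le> (1 + K) * discrepancy \<alpha> b"
proof -
  let ?g = "\<lambda>i x. \<alpha> i x - b i x" and ?h = "\<lambda>i x. \<alpha> i x - \<beta> i x"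
  have g: "?g i \<in> component i" if "i \<in> I" for i
    using component_diff_scaled[OF that \<alpha>[OF that], of "b i" 1] b that by (simp add: block_minimisers_def)
  have h: "?h i \<in> component i" if "i \<in> I" for i
    using component_diff_scaled[OF that \<alpha>[OF that] \<beta>[OF that], of 1] by simp
  have block: "2 * expectation (\<lambda>x. (1 + w i x) * (?g i x * ?h i x)) - expectation (\<lambda>x. w i x * (?h i x)\<^sup>2)
    \<le> (1 + K) * expectation (\<lambda>x. (1 + w i x) * (?g i x)\<^sup>2)" if i: "i \<in> I" for i
  proof -
    have gm: "?g i \<in> borel_measurable M" "?h i \<in> borel_measurable M"
      using component_measurable[OF i] g[OF i] h[OF i] by auto
    have int: "integrable M (\<lambda>x. (1 + w i x) * (?g i x * ?h i x))"
      using w_measurable_M[OF i] w_pos[OF i] g[OF i] h[OF i]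
      by (intro integrable_weighted_mult gm) (auto simp: component_def less_imp_le add_nonneg_nonneg)
    have ineq: "2 * ((1 + v) * (y * z)) - v * z\<^sup>2 \<le> (1 + K) * ((1 + v) * y\<^sup>2)"
      if v: "0 < v" "1 \<le> K * v" for v y z :: real
    proof -
      \<comment> \<open>The left-hand side is a concave quadratic in \<open>z\<close> with maximiser \<open>(1 + v) y / v\<close>.\<close>
      have "0 \<le> (v * z - (1 + v) * y)\<^sup>2" by simp
      then have "v * (2 * ((1 + v) * (y * z)) - v * z\<^sup>2) \<le> (1 + v) * ((1 + v) * y\<^sup>2)"
        by (simp add: power2_eq_square algebra_simps)
      also have "\<dots> \<le> (v * (1 + K)) * ((1 + v) * y\<^sup>2)"
        using v by (intro mult_right_mono) (auto simp: algebra_simps)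
      finally show ?thesis using v(1) by (simp add: mult.assoc)
    qed
    have "expectation (\<lambda>x. 2 * ((1 + w i x) * (?g i x * ?h i x)) - w i x * (?h i x)\<^sup>2) \<le>
      expectation (\<lambda>x. (1 + K) * ((1 + w i x) * (?g i x)\<^sup>2))"
    proof (rule integral_mono_AE)
      show "AE x in M. 2 * ((1 + w i x) * (?g i x * ?h i x)) - w i x * (?h i x)\<^sup>2 \<le>
        (1 + K) * ((1 + w i x) * (?g i x)\<^sup>2)"
        using w_bound[OF i] by eventually_elim (rule ineq[OF w_pos[OF i]])
    qed (use int component_square[OF i h[OF i]] g[OF i] in \<open>auto simp: component_def\<close>)
    then show ?thesis
      using int component_square[OF i h[OF i]] by simp
  qed
  have "energy \<beta> = energy (\<lambda>i x. \<alpha> i x - ?h i x)" by simp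
  also note energy_expansion[OF \<alpha> h b]
  finally have "energy \<alpha> - energy \<beta> = (\<Sum>i\<in>I. 2 * expectation (\<lambda>x. (1 + w i x) * (?g i x * ?h i x)) -
    expectation (\<lambda>x. w i x * (?h i x)\<^sup>2)) - expectation (\<lambda>x. (\<Sum>i\<in>I. ?h i x)\<^sup>2)"
    by (simp add: sum_subtractf sum_distrib_left)
  also have "\<dots> \<le> (\<Sum>i\<in>I. (1 + K) * expectation (\<lambda>x. (1 + w i x) * (?g i x)\<^sup>2)) - 0"
    by (intro diff_mono sum_mono block Bochner_Integration.integral_nonneg) auto
  finally show ?thesis by (simp add: discrepancy_def sum_distrib_left)
qed

lemma energy_nonneg: "0 \<le> energy \<alpha>"
  unfolding energy_def
  by (intro add_nonneg_nonneg sum_nonneg Bochner_Integration.integral_nonneg mult_nonneg_nonneg)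
    (auto simp: w_pos less_imp_le)

lemma energy_cong:
  assumes "\<And>i x. i \<in> I \<Longrightarrow> \<alpha> i x = \<beta> i x"
  shows "energy \<alpha> = energy \<beta>"
proof -
  have "(\<Sum>i\<in>I. \<alpha> i x) = (\<Sum>i\<in>I. \<beta> i x)" for x
    using assms by (rule sum.cong[OF refl])
  moreover have "(\<Sum>i\<in>I. expectation (\<lambda>x. w i x * (\<alpha> i x)\<^sup>2)) = (\<Sum>i\<in>I. expectation (\<lambda>x. w i x * (\<beta> i x)\<^sup>2))"
    using assms by (intro sum.cong refl) simp
  ultimately show ?thesis by (simp only: energy_def)
qed

text \<open>The discrepancy is eliminated between the bounds on the decrease and on the gap.\<close>

theorem energy_contraction:
  assumes \<alpha>: "\<And>i. i \<in> I \<Longrightarrow> \<alpha> i \<in> component i" and \<beta>: "\<And>i. i \<in> I \<Longrightarrow> \<beta> i \<in> component i"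
    and b: "block_minimisers \<alpha> b"
  defines "n \<equiv> real (card I)"
  shows "energy (\<lambda>i x. \<alpha> i x - 1 / n * (\<alpha> i x - b i x)) - energy \<beta> \<le>
    (1 - 1 / (n * (1 + K))) * (energy \<alpha> - energy \<beta>)"
proof -
  have "card I > 0" using finite_I nonempty_I by (simp add: card_gt_0_iff)
  then have n: "0 < n" by (simp add: n_def)
  have "(energy \<alpha> - energy \<beta>) / (n * (1 + K)) \<le> (1 + K) * discrepancy \<alpha> b / (n * (1 + K))"
    using energy_gap[OF \<alpha> \<beta> b] n K_pos by (intro divide_right_mono) auto
  also have "\<dots> = discrepancy \<alpha> b / n"
    using K_pos by simp
  finally have "(energy \<alpha> - energy \<beta>) / (n * (1 + K)) \<le> discrepancy \<alpha> b / n" .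
  then show ?thesis
    using energy_decrease[OF \<alpha> b] unfolding n_def[symmetric] by (simp add: left_diff_distrib)
qed

end

section \<open>Marginal densities and their normalising constants\<close>

text \<open>
  Lebesgue measure on \<open>R^d\<close> in coordinates indexed by \<open>'d\<close> itself. This form allows the coordinates
  to be split into \<open>S\<close> and its complement.
\<close>

lemma lborel_vec_eq_PiM:
  "(lborel :: (real ^ 'd) measure) = distr (Pi\<^sub>M UNIV (\<lambda>_. lborel)) borel (\<lambda>\<omega>. \<chi> j. \<omega> j)"
proof (rule lborel_eqI)
  interpret product_sigma_finite "\<lambda>_::'d. lborel :: real measure" ..
  have "(\<lambda>\<omega>. \<chi> j. \<omega> j) \<in> borel_measurable (Pi\<^sub>M UNIV (\<lambda>_. lborel))"
    (is "?v \<in> _")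
    by (subst borel_measurable_euclidean_space) (auto simp: Basis_vec_def inner_axis)
  note [measurable] = this
  have Basis: "(Basis :: (real ^ 'd) set) = range (\<lambda>i. axis i 1)"
    by (auto simp: Basis_vec_def)
  fix l u :: "real ^ 'd" assume lu: "\<And>b. b \<in> Basis \<Longrightarrow> l \<bullet> b \<le> u \<bullet> b"
  have le: "l $ i \<le> u $ i" for i
    using lu[of "axis i 1"] by (simp add: inner_axis)
  have "emeasure (distr (Pi\<^sub>M UNIV (\<lambda>_. lborel)) borel ?v) (box l u) =
    emeasure (Pi\<^sub>M UNIV (\<lambda>_. lborel)) (\<Pi>\<^sub>E i\<in>UNIV. {l $ i <..< u $ i})"
    by (subst emeasure_distr) (auto simp: space_PiM PiE_iff mem_box_cart intro!: arg_cong[of _ _ "emeasure _"])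
  also have "\<dots> = (\<Prod>i\<in>UNIV. ennreal (u $ i - l $ i))"
    using le by (subst emeasure_PiM) auto
  also have "\<dots> = ennreal (\<Prod>i\<in>UNIV. u $ i - l $ i)"
    using le by (intro prod_ennreal) simp
  also have "(\<Prod>i\<in>UNIV. u $ i - l $ i) = (\<Prod>b\<in>Basis. (u - l) \<bullet> b)"
    unfolding Basis by (subst prod.reindex) (auto simp: inj_on_def axis_eq_axis inner_axis)
  finally show "emeasure (distr (Pi\<^sub>M UNIV (\<lambda>_. lborel)) borel ?v) (box l u) =
    ennreal (\<Prod>b\<in>Basis. (u - l) \<bullet> b)" .
qed simp

lemma integral_marginal_density:
  fixes f :: "real ^ 'd \<Rightarrow> real"
  assumes "prob_density f"
  shows "(LINT z | Pi\<^sub>M S (\<lambda>_. lborel). marginal_density f S z) = 1"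
proof -
  interpret product_sigma_finite "\<lambda>_::'d. lborel :: real measure" ..
  let ?P = "Pi\<^sub>M (UNIV :: 'd set) (\<lambda>_. lborel :: real measure)"
  let ?v = "\<lambda>\<omega>. (\<chi> j. \<omega> j) :: real ^ 'd"
  have v: "?v \<in> measurable ?P borel"
    by (subst borel_measurable_euclidean_space) (auto simp: Basis_vec_def inner_axis)
  have f: "integrable lborel f" "(LINT x | lborel. f x) = 1"
    using assms by (auto simp: prob_density_def has_bochner_integral_iff)
  then have fm: "f \<in> borel_measurable borel" by auto
  have int: "integrable ?P (\<lambda>\<omega>. f (?v \<omega>))"
    using f(1) v fm by (subst (asm) lborel_vec_eq_PiM) (simp add: integrable_distr_eq)
  have "1 = (LINT \<omega> | ?P. f (?v \<omega>))"
    using f(2) v fm by (subst (asm) lborel_vec_eq_PiM) (simp add: integral_distr)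
  also have "\<dots> = (LINT z | Pi\<^sub>M S (\<lambda>_. lborel). LINT y | Pi\<^sub>M (- S) (\<lambda>_. lborel). f (?v (merge S (- S) (z, y))))"
    using product_integral_fold[of S "- S" "\<lambda>\<omega>. f (?v \<omega>)"] int by simp
  also have "(\<lambda>z y. ?v (merge S (- S) (z, y))) = glue S"
    by (auto simp: fun_eq_iff vec_eq_iff glue_def merge_def)
  then have "(LINT z | Pi\<^sub>M S (\<lambda>_. lborel). LINT y | Pi\<^sub>M (- S) (\<lambda>_. lborel). f (?v (merge S (- S) (z, y)))) =
    (LINT z | Pi\<^sub>M S (\<lambda>_. lborel). marginal_density f S z)"
    unfolding marginal_density_def by (metis (no_types))
  finally show ?thesis by simp
qed

text \<open>
  Positivity matters because division by a vanishing normaliser would make the normalised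
  function, and with it the penalty, identically zero. If the integral vanished, the
  positive factor \<open>r\<close> would force \<open>f\<^sub>S\<close> to be zero almost everywhere, although it integrates to 1.
\<close>

lemma normaliser_pos:
  assumes f: "prob_density f"
    and r: "\<And>z. z \<in> (\<Pi>\<^sub>E j\<in>S. UNIV) \<Longrightarrow> 0 < r z"
    and int: "integrable (Pi\<^sub>M S (\<lambda>_. lborel)) (\<lambda>z. r z * marginal_density f S z)"
  shows "0 < (LINT z | Pi\<^sub>M S (\<lambda>_. lborel). r z * marginal_density f S z)"
proof (rule ccontr)
  let ?P = "Pi\<^sub>M S (\<lambda>_. lborel :: real measure)"
  have m: "0 \<le> marginal_density f S z" for z
    using f unfolding marginal_density_def by (intro Bochner_Integration.integral_nonneg) (simp add: prob_density_def)
  have sp: "0 < r z" if "z \<in> space ?P" for z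
    using r that by (simp add: space_PiM)
  have nn: "AE z in ?P. 0 \<le> r z * marginal_density f S z"
    using sp m by (intro AE_I2 mult_nonneg_nonneg) (auto simp: less_imp_le)
  assume "\<not> ?thesis"
  then have "(LINT z | ?P. r z * marginal_density f S z) = 0"
    using integral_nonneg_AE[OF nn] by linarith
  then have "AE z in ?P. r z * marginal_density f S z = 0"
    using integral_nonneg_eq_0_iff_AE[OF int nn] by simp
  then have "AE z in ?P. marginal_density f S z = 0"
    using AE_space by eventually_elim (use sp in force)
  then have "(LINT z | ?P. marginal_density f S z) = 0"
    by (rule integral_eq_zero_AE)
  then show False using integral_marginal_density[OF f, of S] by simp
qed

section \<open>The additive model of a density\<close>

lemma prob_density_measurable: "prob_density f \<Longrightarrow> f \<in> borel_measurable borel"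
  by (auto simp: prob_density_def has_bochner_integral_iff)

lemma prob_space_law: "prob_density f \<Longrightarrow> prob_space (law f)"
proof
  assume f: "prob_density f"
  note [measurable] = prob_density_measurable[OF f]
  have "emeasure (law f) (space (law f)) = (\<integral>\<^sup>+ x. ennreal (f x) \<partial>lborel)"
    by (simp add: law_def emeasure_density)
  also have "\<dots> = ennreal (LINT x | lborel. f x)"
    using f by (intro nn_integral_eq_integral) (auto simp: prob_density_def has_bochner_integral_iff)
  finally show "emeasure (law f) (space (law f)) = 1"
    using f by (simp add: prob_density_def has_bochner_integral_iff)
qed

lemma space_law [simp]: "space (law f) = UNIV"
  by (simp add: law_def)

lemma sets_law [simp, measurable_cong]: "sets (law f) = sets borel"
  by (simp add: law_def)

lemma L2_iff:
  assumes "prob_density f"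
  shows "\<alpha> \<in> L2 f \<longleftrightarrow> \<alpha> \<in> borel_measurable borel \<and> integrable (law f) (\<lambda>x. (\<alpha> x)\<^sup>2)"
proof -
  have [measurable]: "f \<in> borel_measurable borel" and nn: "AE x in lborel. 0 \<le> f x"
    using assms prob_density_measurable by (auto simp: prob_density_def)
  show ?thesis
    unfolding L2_def law_def
    using integrable_density[OF _ _ nn, of "\<lambda>x. (\<alpha> x)\<^sup>2"]
    by (auto simp: mult.commute)
qed

lemma integral_law:
  fixes g :: "real ^ 'd \<Rightarrow> real"
  assumes "prob_density f" "g \<in> borel_measurable borel"
  shows "(LINT x | law f. g x) = (LINT x | lborel. g x * f x)"
  using assms prob_density_measurable[OF assms(1)] unfolding law_def
  by (subst integral_density) (auto simp: prob_density_def mult.commute)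

lemma coords_measurable: "coords S \<in> measurable borel (Pi\<^sub>M S (\<lambda>_. borel))"
  unfolding coords_def by (intro measurable_restrict) auto

lemma coords_measurable_algebra: "coords S \<in> measurable (coords_algebra S) (Pi\<^sub>M S (\<lambda>_. borel))"
  unfolding coords_algebra_def
  by (rule measurable_vimage_algebra1) (auto simp: space_PiM coords_def)

lemma subalgebra_coords: "subalgebra (law f) (coords_algebra S)"
  unfolding subalgebra_def
proof
  show "space (coords_algebra S) = space (law f)"
    by (simp add: coords_algebra_def)
  show "sets (coords_algebra S) \<subseteq> sets (law f)"
    using measurable_sets[OF coords_measurable, of _ S]
    by (auto simp: coords_algebra_def sets_vimage_algebra2 space_PiM coords_def)
qed

text \<open>
  A function that depends only on \<open>x\<^sub>S\<close> is its own composition with the map that resets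
  the coordinates outside \<open>S\<close> to 0, and this map factors through \<open>x\<^sub>S\<close>.
\<close>

lemma measurable_coords_algebraI:
  assumes \<alpha>: "\<alpha> \<in> borel_measurable borel" and dep: "\<And>x y. coords S x = coords S y \<Longrightarrow> \<alpha> x = \<alpha> y"
  shows "\<alpha> \<in> borel_measurable (coords_algebra S)"
proof -
  have "(\<lambda>z. if j \<in> S then z j else 0 :: real) \<in> borel_measurable (Pi\<^sub>M S (\<lambda>_. borel))" for j
    by (cases "j \<in> S") auto
  then have g: "(\<lambda>z. glue S z (\<lambda>_. 0)) \<in> borel_measurable (Pi\<^sub>M S (\<lambda>_. borel))"
    by (subst borel_measurable_euclidean_space) (auto simp: Basis_vec_def inner_axis glue_def)
  have "\<alpha> x = \<alpha> (glue S (coords S x) (\<lambda>_. 0))" for x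
    by (rule dep) (auto simp: coords_def glue_def restrict_def)
  then show ?thesis
    using measurable_compose[OF measurable_compose[OF coords_measurable_algebra g] \<alpha>]
    by (simp cong: measurable_cong)
qed

locale density_additive_model =
  fixes f a :: "real ^ 'd \<Rightarrow> real" and SS :: "'d set set" and lam :: "'d set \<Rightarrow> real"
    and r :: "'d set \<Rightarrow> ('d \<Rightarrow> real) \<Rightarrow> real" and C :: real
  assumes f: "prob_density f" and nonempty: "SS \<noteq> {}"
    and lam_pos: "S \<in> SS \<Longrightarrow> 0 < lam S"
    and r_measurable: "S \<in> SS \<Longrightarrow> r S \<in> borel_measurable (Pi\<^sub>M S (\<lambda>_. borel))"
    and r_pos: "S \<in> SS \<Longrightarrow> z \<in> (\<Pi>\<^sub>E j\<in>S. UNIV) \<Longrightarrow> 0 < r S z"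
    and r_integrable: "S \<in> SS \<Longrightarrow>
      integrable (Pi\<^sub>M S (\<lambda>_. lborel)) (\<lambda>z. r S z * marginal_density f S z)"
    and a: "a \<in> L2 f"
    and bounded: "S \<in> SS \<Longrightarrow> AE x in law f. normalised f r S (coords S x) \<le> C"
begin

definition weight :: "'d set \<Rightarrow> real ^ 'd \<Rightarrow> real" where
  "weight S x = 1 / (lam S * normalised f r S (coords S x))"

lemma normalised_pos: "S \<in> SS \<Longrightarrow> 0 < normalised f r S (coords S x)"
  unfolding normalised_def
  using normaliser_pos[OF f r_pos r_integrable] r_pos[of S "coords S x"]
  by (intro divide_pos_pos) (auto simp: coords_def)

lemma weight_pos: "S \<in> SS \<Longrightarrow> 0 < weight S x"
  by (simp add: weight_def lam_pos normalised_pos)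

sublocale penalised_additive_model "law f" SS coords_algebra weight a "C * Max (lam ` SS)"
proof (rule penalised_additive_model.intro[OF prob_space_law[OF f]], unfold_locales)
  fix S assume S: "S \<in> SS"
  show "weight S \<in> borel_measurable (coords_algebra S)"
    unfolding weight_def[abs_def] normalised_def
    using measurable_compose[OF coords_measurable_algebra r_measurable[OF S]] by measurable
  have lam_le: "lam S \<le> Max (lam ` SS)" using S by simp
  show "AE x in law f. 1 \<le> C * Max (lam ` SS) * weight S x"
    using bounded[OF S]
  proof eventually_elim
    case (elim x)
    have "lam S * normalised f r S (coords S x) \<le> Max (lam ` SS) * C"
      using elim lam_le lam_pos[OF S] normalised_pos[OF S, of x] by (intro mult_mono) auto
    then show ?case
      using lam_pos[OF S] normalised_pos[OF S, of x]
      by (simp add: weight_def le_divide_eq mult.commute)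
  qed
qed (use nonempty a L2_iff[OF f, of a] in \<open>auto simp: weight_pos subalgebra_coords\<close>)

lemma penalty_eq_weight:
  "(y::real)\<^sup>2 / (lam S * normalised f r S (coords S x)) = weight S x * y\<^sup>2"
  by (simp add: weight_def)

lemma loss_eq_energy:
  assumes \<alpha>: "\<And>S. S \<in> SS \<Longrightarrow> \<alpha> S \<in> component S"
  shows "loss f a SS lam r \<alpha> = ereal (energy \<alpha>)"
proof -
  have "expectation (\<lambda>x. a x - (\<Sum>S\<in>SS. \<alpha> S x)) = expectation a - (\<Sum>S\<in>SS. expectation (\<alpha> S))"
    using a_integrable component_integrable \<alpha> by (simp add: Bochner_Integration.integral_sum)
  also have "\<dots> = expectation a"
    using sum.neutral[of SS "\<lambda>S. expectation (\<alpha> S)"] component_expectation[OF \<alpha>] by simp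
  finally have "variance (\<lambda>x. a x - (\<Sum>S\<in>SS. \<alpha> S x)) =
    expectation (\<lambda>x. (a x - expectation a - (\<Sum>S\<in>SS. \<alpha> S x))\<^sup>2)"
    by (simp add: algebra_simps)
  moreover have "enn2ereal (\<integral>\<^sup>+ x. ennreal ((\<alpha> S x)\<^sup>2 / (lam S * normalised f r S (coords S x))) \<partial>law f) =
    ereal (expectation (\<lambda>x. weight S x * (\<alpha> S x)\<^sup>2))" if S: "S \<in> SS" for S
  proof -
    have nn: "0 \<le> weight S x * (\<alpha> S x)\<^sup>2" for x
      using weight_pos[OF S, of x] by simp
    show ?thesis
      unfolding penalty_eq_weight
      using nn by (subst nn_integral_eq_integral[OF component_square(2)[OF S \<alpha>[OF S]]]) simp_all
  qed
  ultimately show ?thesis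
    unfolding loss_def energy_def by (simp add: sum_ereal)
qed

text \<open>
  On elements with finite penalties the extended real loss is the real-valued energy; on all other
  elements of the product of the \<open>H f S\<close> it is infinite. The next lemmas separate these cases.
\<close>

lemma component_if_penalty_finite:
  assumes S: "S \<in> SS" and h: "h \<in> H f S"
    and fin: "(\<integral>\<^sup>+ x. ennreal ((h x)\<^sup>2 / (lam S * normalised f r S (coords S x))) \<partial>law f) \<noteq> \<infinity>"
  shows "h \<in> component S"
proof (rule componentI[OF S])
  have L2: "h \<in> L2 f" and dep: "\<And>x y. coords S x = coords S y \<Longrightarrow> h x = h y"
    and mean: "(LINT x | lborel. h x * f x) = 0"
    using h unfolding H_def by blast+
  have hm: "h \<in> borel_measurable borel" and sq: "integrable (law f) (\<lambda>x. (h x)\<^sup>2)"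
    using L2 by (simp_all add: L2_iff[OF f])
  then have [measurable]: "h \<in> borel_measurable (law f)" by simp
  note [measurable] = w_measurable_M[OF S]
  show "integrable (law f) (\<lambda>x. (h x)\<^sup>2)" by fact
  show "h \<in> borel_measurable (coords_algebra S)"
    by (rule measurable_coords_algebraI[OF hm dep])
  show "expectation h = 0"
    by (simp add: integral_law[OF f hm] mean)
  show "integrable (law f) (\<lambda>x. weight S x * (h x)\<^sup>2)"
    using fin weight_pos[OF S] unfolding penalty_eq_weight
    by (intro integrableI_nonneg) (auto simp: less_imp_le less_top)
qed

lemma loss_infinite:
  assumes "\<beta> \<in> H_prod f SS" "S \<in> SS" "\<beta> S \<notin> component S"
  shows "loss f a SS lam r \<beta> = \<infinity>"
proof -
  have "\<beta> S \<in> H f S" using assms by (auto simp: H_prod_def)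
  then have "(\<integral>\<^sup>+ x. ennreal ((\<beta> S x)\<^sup>2 / (lam S * normalised f r S (coords S x))) \<partial>law f) = \<infinity>"
    using component_if_penalty_finite assms by blast
  then have "(\<Sum>S\<in>SS. enn2ereal (\<integral>\<^sup>+ x. ennreal ((\<beta> S x)\<^sup>2 / (lam S * normalised f r S (coords S x))) \<partial>law f)) = \<infinity>"
    using assms(2) by (subst sum_Pinfty) (auto intro!: bexI[of _ S])
  then show ?thesis unfolding loss_def by simp
qed

section \<open>The iterates\<close>

text \<open>
  The factor \<open>p / (1 + p)\<close> of the update, with \<open>p = 1 / w\<close>, is the shrinkage \<open>1 / (1 + w)\<close> of
  the block minimiser.
\<close>

lemma update_eq_target:
  assumes "S \<in> SS"
  shows "update f a SS lam r \<eta> \<alpha> S t x = \<alpha> S x - \<eta> * (\<alpha> S x - target \<alpha> S t x)"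
proof -
  define p where "p = lam S * normalised f r S (coords S x)"
  define c where "c = real_cond_exp (law f) (coords_algebra S) (\<lambda>y. a y - (\<Sum>S'\<in>SS - {S}. \<alpha> S' y) - t) x"
  have "0 < p" using assms by (simp add: p_def lam_pos normalised_pos)
  then have "p / (1 + p) = 1 / (1 + 1 / p)" by (simp add: divide_simps)
  moreover have "target \<alpha> S t x = c / (1 + 1 / p)"
    by (simp add: target_def weight_def p_def c_def)
  moreover have "update f a SS lam r \<eta> \<alpha> S t x = (1 - \<eta>) * \<alpha> S x + \<eta> * (p / (1 + p)) * c"
    by (simp add: update_def p_def c_def)
  ultimately show ?thesis by (simp add: algebra_simps)
qed

text \<open>
  As \<open>\<alpha> S\<close> has mean zero and \<open>\<eta>\<close> is nonzero, centring the update is the same as centring the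
  target, so the description of the centring constant as the unique solution transfers.
\<close>

lemma centring_target:
  assumes S: "S \<in> SS" and \<alpha>: "\<And>S. S \<in> SS \<Longrightarrow> \<alpha> S \<in> component S" and \<eta>: "\<eta> \<noteq> 0"
  shows "expectation (target \<alpha> S (centring f a SS lam r \<eta> \<alpha> S)) = 0"
proof -
  have "(LINT x | law f. update f a SS lam r \<eta> \<alpha> S t x) = \<eta> * expectation (target \<alpha> S t)" for t
    unfolding update_eq_target[OF S]
    using component_integrable[OF S \<alpha>[OF S]] component_expectation[OF \<alpha>[OF S]]
      target_integrable[where \<alpha>=\<alpha> and t=t, OF S \<alpha>] by simp
  then have "centring f a SS lam r \<eta> \<alpha> S = (THE t. expectation (target \<alpha> S t) = 0)"
    using \<eta> by (simp add: centring_def)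
  then show ?thesis
    using theI'[OF target_centring_unique[where \<alpha>=\<alpha>, OF S \<alpha>]] by simp
qed

lemma iterate_Suc_step:
  assumes \<eta>: "\<eta> \<noteq> 0" and \<alpha>: "\<And>S. S \<in> SS \<Longrightarrow> iterate f a SS lam r \<eta> M S \<in> component S"
  obtains b where "block_minimisers (iterate f a SS lam r \<eta> M) b"
    "\<And>S x. S \<in> SS \<Longrightarrow> iterate f a SS lam r \<eta> (Suc M) S x =
       iterate f a SS lam r \<eta> M S x - \<eta> * (iterate f a SS lam r \<eta> M S x - b S x)"
proof
  let ?\<alpha> = "iterate f a SS lam r \<eta> M"
  let ?b = "\<lambda>S. target ?\<alpha> S (centring f a SS lam r \<eta> ?\<alpha> S)"
  show "block_minimisers ?\<alpha> ?b"
    unfolding block_minimisers_def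
    using target_block_minimiser[where \<alpha>="?\<alpha>", OF _ \<alpha> centring_target[where \<alpha>="?\<alpha>", OF _ \<alpha> \<eta>]]
    by blast
  show "iterate f a SS lam r \<eta> (Suc M) S x = ?\<alpha> S x - \<eta> * (?\<alpha> S x - ?b S x)" if "S \<in> SS" for S x
    using that by (simp add: update_eq_target)
qed

lemma iterate_component:
  assumes \<eta>: "\<eta> \<noteq> 0" and S: "S \<in> SS"
  shows "iterate f a SS lam r \<eta> M S \<in> component S"
  using S
proof (induction M arbitrary: S)
  case 0
  then show ?case by (simp add: component_def)
next
  case (Suc M)
  obtain b where b: "block_minimisers (iterate f a SS lam r \<eta> M) b"
    and step: "\<And>S x. S \<in> SS \<Longrightarrow> iterate f a SS lam r \<eta> (Suc M) S x =
       iterate f a SS lam r \<eta> M S x - \<eta> * (iterate f a SS lam r \<eta> M S x - b S x)"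
    using iterate_Suc_step[OF \<eta> Suc.IH] by blast
  have bS: "b S \<in> component S" using b Suc.prems by (simp add: block_minimisers_def)
  have "(\<lambda>x. iterate f a SS lam r \<eta> M S x - 1 * b S x) \<in> component S"
    by (rule component_diff_scaled[OF Suc.prems Suc.IH[OF Suc.prems] bS])
  from component_diff_scaled[OF Suc.prems Suc.IH[OF Suc.prems] this, of \<eta>]
  show ?case
    unfolding ext[of "iterate f a SS lam r \<eta> (Suc M) S", OF step[OF Suc.prems]] by simp
qed

lemma energy_iterate_step:
  defines "n \<equiv> real (card SS)"
  defines "\<alpha> \<equiv> iterate f a SS lam r (1 / n)"
  assumes \<beta>: "\<And>S. S \<in> SS \<Longrightarrow> \<beta> S \<in> component S"
  shows "energy (\<alpha> (Suc M)) \<le> energy (\<alpha> M)"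
    and "energy (\<alpha> (Suc M)) - energy \<beta> \<le>
      (1 - 1 / (n * (1 + C * Max (lam ` SS)))) * (energy (\<alpha> M) - energy \<beta>)"
proof -
  have n: "0 < n" using nonempty by (simp add: n_def card_gt_0_iff)
  then have nz: "1 / n \<noteq> 0" by simp
  have comp: "\<alpha> M S \<in> component S" if "S \<in> SS" for S
    unfolding \<alpha>_def by (rule iterate_component[OF nz that])
  obtain b where "block_minimisers (iterate f a SS lam r (1 / n) M) b"
    and "\<And>S x. S \<in> SS \<Longrightarrow> iterate f a SS lam r (1 / n) (Suc M) S x =
       iterate f a SS lam r (1 / n) M S x - 1 / n * (iterate f a SS lam r (1 / n) M S x - b S x)"
    using iterate_Suc_step[OF nz iterate_component[OF nz]] by blast
  then have b: "block_minimisers (\<alpha> M) b"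
    and step: "\<And>S x. S \<in> SS \<Longrightarrow> \<alpha> (Suc M) S x = \<alpha> M S x - 1 / n * (\<alpha> M S x - b S x)"
    unfolding \<alpha>_def by blast+
  have E: "energy (\<alpha> (Suc M)) = energy (\<lambda>S x. \<alpha> M S x - 1 / n * (\<alpha> M S x - b S x))"
    using step by (rule energy_cong)
  have "0 \<le> discrepancy (\<alpha> M) b / n"
    using n discrepancy_nonneg by simp
  then show "energy (\<alpha> (Suc M)) \<le> energy (\<alpha> M)"
    using energy_decrease[OF comp b] unfolding E n_def by linarith
  show "energy (\<alpha> (Suc M)) - energy \<beta> \<le>
      (1 - 1 / (n * (1 + C * Max (lam ` SS)))) * (energy (\<alpha> M) - energy \<beta>)"
    using energy_contraction[OF comp \<beta> b] unfolding E n_def by simp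
qed

text \<open>
  The induction starts from the zero function, whose energy is the variance of \<open>a\<close>, and the energy
  of \<open>\<beta>\<close> is nonnegative. That \<open>\<kappa> \<ge> 1\<close> makes the contraction factor nonnegative, so that the
  steps can be chained.
\<close>

lemma energy_iterate_gap:
  defines "n \<equiv> real (card SS)"
  defines "\<kappa> \<equiv> n * (1 + C * Max (lam ` SS))"
  assumes \<beta>: "\<And>S. S \<in> SS \<Longrightarrow> \<beta> S \<in> component S"
  shows "energy (iterate f a SS lam r (1 / n) M) - energy \<beta> \<le> (1 - 1 / \<kappa>) ^ M * variance a"
    and "1 \<le> \<kappa>"
proof -
  have "0 < card SS" using nonempty by (simp add: card_gt_0_iff)
  then have "1 \<le> n" by (simp add: n_def)
  then have "1 * 1 \<le> \<kappa>"
    unfolding \<kappa>_def using K_pos by (intro mult_mono) auto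
  then show \<kappa>: "1 \<le> \<kappa>" by simp
  show "energy (iterate f a SS lam r (1 / n) M) - energy \<beta> \<le> (1 - 1 / \<kappa>) ^ M * variance a"
  proof (induction M)
    case 0
    show ?case using energy_nonneg[of \<beta>] by (simp add: energy_def)
  next
    case (Suc M)
    have "energy (iterate f a SS lam r (1 / n) (Suc M)) - energy \<beta> \<le>
      (1 - 1 / \<kappa>) * (energy (iterate f a SS lam r (1 / n) M) - energy \<beta>)"
      using energy_iterate_step(2)[where \<beta>=\<beta>, OF \<beta>] unfolding \<kappa>_def n_def .
    also have "\<dots> \<le> (1 - 1 / \<kappa>) * ((1 - 1 / \<kappa>) ^ M * variance a)"
      using \<kappa> by (intro mult_left_mono Suc.IH) simp
    finally show ?case by (simp add: mult.assoc)
  qed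
qed

end

theorem proposition12:
  fixes f a :: "real ^ 'd \<Rightarrow> real"
    and SS :: "'d set set"
    and lam :: "'d set \<Rightarrow> real"
    and r :: "'d set \<Rightarrow> ('d \<Rightarrow> real) \<Rightarrow> real"
    and \<alpha>_opt :: "'d set \<Rightarrow> real ^ 'd \<Rightarrow> real"
    and C \<kappa> \<eta> lam_max :: real
  assumes "2 \<le> CARD('d)"
    and "prob_density f"
    and "SS \<noteq> {}" and "UNIV \<notin> SS"
    and "\<And>S. S \<in> SS \<Longrightarrow> 0 < lam S"
    and "\<And>S. S \<in> SS \<Longrightarrow> r S \<in> borel_measurable (Pi\<^sub>M S (\<lambda>_. borel))"
    and "\<And>S z. S \<in> SS \<Longrightarrow> z \<in> (\<Pi>\<^sub>E j\<in>S. UNIV) \<Longrightarrow> 0 < r S z"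
    and "\<And>S. S \<in> SS \<Longrightarrow> integrable (Pi\<^sub>M S (\<lambda>_. lborel)) (\<lambda>z. r S z * marginal_density f S z)"
    and "a \<in> L2 f"
    and "is_arg_min (loss f a SS lam r) (\<lambda>\<beta>. \<beta> \<in> H_prod f SS) \<alpha>_opt"
    and "lam_max = Max (lam ` SS)"
    and "\<And>S. S \<in> SS \<Longrightarrow>
           esssup (law f) (\<lambda>x. ereal \<bar>normalised f r S (coords S x)\<bar>) \<le> ereal C"
    and "\<eta> = 1 / real (card SS)"
    and "\<kappa> = real (card SS) * (1 + C * lam_max)"
  shows "(\<forall>M. loss f a SS lam r (iterate f a SS lam r \<eta> M) - loss f a SS lam r \<alpha>_opt
              \<le> ereal (\<kappa> * (1 - 1 / \<kappa>) ^ M * prob_space.variance (law f) a))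
       \<and> (\<forall>M. loss f a SS lam r (iterate f a SS lam r \<eta> (Suc M))
              \<le> loss f a SS lam r (iterate f a SS lam r \<eta> M))"
proof -
  interpret density_additive_model f a SS lam r C
  proof
    fix S assume "S \<in> SS"
    show "AE x in law f. normalised f r S (coords S x) \<le> C"
      using esssup_AE[of "\<lambda>x. ereal \<bar>normalised f r S (coords S x)\<bar>" "law f"]
    proof eventually_elim
      case (elim x)
      then have "ereal \<bar>normalised f r S (coords S x)\<bar> \<le> ereal C"
        using assms(12)[OF \<open>S \<in> SS\<close>] by (rule order_trans)
      then show ?case by simp
    qed
  qed (fact assms)+
  have \<eta>: "\<eta> \<noteq> 0"
    unfolding assms(13) using assms(3) by simp
  have loss: "loss f a SS lam r (iterate f a SS lam r \<eta> M) =
    ereal (energy (iterate f a SS lam r \<eta> M))" for M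
    by (rule loss_eq_energy) (rule iterate_component[OF \<eta>])
  have opt: "\<alpha>_opt \<in> H_prod f SS"
    using assms(10) by (simp add: is_arg_min_def)
  have "loss f a SS lam r (iterate f a SS lam r \<eta> M) - loss f a SS lam r \<alpha>_opt
    \<le> ereal (\<kappa> * (1 - 1 / \<kappa>) ^ M * variance a)" for M
  proof (cases "\<forall>S\<in>SS. \<alpha>_opt S \<in> component S")
    case True
    then have comp: "\<And>S. S \<in> SS \<Longrightarrow> \<alpha>_opt S \<in> component S" by simp
    have gap: "energy (iterate f a SS lam r \<eta> M) - energy \<alpha>_opt \<le> (1 - 1 / \<kappa>) ^ M * variance a"
      and \<kappa>: "1 \<le> \<kappa>"
      using energy_iterate_gap[where \<beta>=\<alpha>_opt, OF comp] assms(11,13,14) by simp_all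
    \<comment> \<open>The factor \<open>\<kappa> \<ge> 1\<close> enlarges a nonnegative bound.\<close>
    have "0 \<le> (1 - 1 / \<kappa>) ^ M * variance a"
      using \<kappa> variance_positive[of a] by simp
    then have "(1 - 1 / \<kappa>) ^ M * variance a \<le> \<kappa> * ((1 - 1 / \<kappa>) ^ M * variance a)"
      using mult_right_mono[OF \<kappa>] by force
    then show ?thesis
      using gap by (simp add: loss loss_eq_energy[of \<alpha>_opt, OF comp] mult.assoc)
  next
    case False
    \<comment> \<open>The subtracted loss is infinite, so the difference is \<open>- \<infinity>\<close>.\<close>
    then show ?thesis
      using loss_infinite[OF opt] by (auto simp: loss)
  qed
  moreover have "loss f a SS lam r (iterate f a SS lam r \<eta> (Suc M)) \<le>
    loss f a SS lam r (iterate f a SS lam r \<eta> M)" for M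
    using energy_iterate_step(1)[where \<beta>="\<lambda>_ _. 0"] assms(13)
    unfolding loss by (simp add: component_def del: iterate.simps)
  ultimately show ?thesis by blast
qed

end
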